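(* Let $\mathcal A^+=\mathbb C\langle u,v\rangle$ be the free associative algebra on two generators, and let $\delta_1,\delta_2,\widetilde{\delta_1},\widetilde{\delta_2}\in\mathcal D_{\mathcal A^+}$ be the noncommutative vector fields determined by $$\delta_1(u)=1\otimes u,\quad \delta_1(v)=1\otimes v,\qquad \delta_2(u)=u\otimes 1,\quad \delta_2(v)=0,$$ $$\widetilde{\delta_1}(u)=u\otimes 1,\quad \widetilde{\delta_1}(v)=v\otimes 1,\qquad \widetilde{\delta_2}(u)=1\otimes u,\quad \widetilde{\delta_2}(v)=0.$$ Let $\{\!\!\{\_,\_\}\!\!\}_K:\mathcal A^+\otimes\mathcal A^+\to\mathcal A^+\otimes\mathcal A^+$ be the biderivation defined on generators by $$\{\!\!\{u,v\}\!\!\}_K=-vu\otimes 1,\quad \{\!\!\{v,u\}\!\!\}_K=uv\otimes 1,\quad \{\!\!\{u,u\}\!\!\}_K=\{\!\!\{v,v\}\!\!\}_K=0.$$ Then $$\{\!\!\{\_,\_\}\!\!\}_K=\mathrm{tr}_{\mathcal A^+}\left(\delta_1\star\delta_2-\widetilde{\delta_2}\star\widetilde{\delta_1}\right).$$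
   Context: Tensor products are over $\mathbb C$, and products in $\mathcal A\otimes\mathcal A$ are componentwise. For an associative algebra $\mathcal A$, a noncommutative vector field is a linear map $\delta:\mathcal A\to\mathcal A\otimes\mathcal A$, written $\delta(a)=\delta(a)'\otimes\delta(a)''$ (sum suppressed), with $\delta(ab)=(a\otimes 1)\delta(b)+\delta(a)(1\otimes b)$; the space of these is $\mathcal D_{\mathcal A}$. A biderivation is a linear map $R:\mathcal A\otimes\mathcal A\to\mathcal A\otimes\mathcal A$ with $R(ab\otimes c)=(1\otimes a)R(b\otimes c)+R(a\otimes c)(b\otimes 1)$ and $R(a\otimes bc)=(b\otimes 1)R(a\otimes c)+R(a\otimes b)(1\otimes c)$ for all $a,b,c$. A biderivation of a free algebra is determined by its values on pairs of generators. For $\delta,\eta\in\mathcal D_{\mathcal A}$, $\delta\star\eta$ is their product in the algebra of noncommutative poly-vector fields (the tensor algebra of the $\mathcal A$-bimodule $\mathcal D_{\mathcal A}$), and its partial trace is regarded as the biderivation $$\mathrm{tr}_{\mathcal A}(\delta\star\eta)(a\otimes b)=\eta(b)'\delta(a)''\otimes\delta(a)'\eta(b)'',$$ extended linearly to sums of such products. *)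

theory Defs
  imports Complex_Main "HOL-Library.Poly_Mapping"
begin

section \<open>Complex vector spaces and unital associative algebras\<close>

class scaleC =
  fixes scaleC :: "complex \<Rightarrow> 'a \<Rightarrow> 'a"  (infixr \<open>*\<^sub>C\<close> 75)

class complex_vector = scaleC + ab_group_add +
  assumes scaleC_add_right: "c *\<^sub>C (x + y) = c *\<^sub>C x + c *\<^sub>C y"
    and scaleC_add_left: "(c + d) *\<^sub>C x = c *\<^sub>C x + d *\<^sub>C x"
    and scaleC_scaleC: "c *\<^sub>C d *\<^sub>C x = (c * d) *\<^sub>C x"
    and scaleC_one: "1 *\<^sub>C x = x"

text \<open>\<^class>\<open>ring\<close> together with \<^class>\<open>monoid_mult\<close> rather than \<^class>\<open>ring_1\<close>, so that
  the zero algebra is not excluded.\<close>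

class complex_algebra = complex_vector + ring + monoid_mult +
  assumes scaleC_mult_left: "(c *\<^sub>C x) * y = c *\<^sub>C (x * y)"
    and scaleC_mult_right: "x * (c *\<^sub>C y) = c *\<^sub>C (x * y)"

global_interpretation cvec: vector_space "scaleC :: complex \<Rightarrow> 'a \<Rightarrow> 'a::complex_vector"
  by standard (fact scaleC_add_right scaleC_add_left scaleC_scaleC scaleC_one)+

abbreviation clinear :: "('a::complex_vector \<Rightarrow> 'b::complex_vector) \<Rightarrow> bool"
  where "clinear \<equiv> Vector_Spaces.linear scaleC scaleC"

definition cbilinear :: "('a::complex_vector \<Rightarrow> 'b::complex_vector \<Rightarrow> 'c::complex_vector) \<Rightarrow> bool"
  where "cbilinear f \<longleftrightarrow> (\<forall>a. clinear (\<lambda>b. f a b)) \<and> (\<forall>b. clinear (\<lambda>a. f a b))"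

lemma clinear_iff:
  "clinear f \<longleftrightarrow> (\<forall>x y. f (x + y) = f x + f y) \<and> (\<forall>c x. f (c *\<^sub>C x) = c *\<^sub>C f x)"
  by (auto simp: Vector_Spaces.linear_iff intro: cvec.vector_space_axioms)

lemma clinearI:
  "(\<And>x y. f (x + y) = f x + f y) \<Longrightarrow> (\<And>c x. f (c *\<^sub>C x) = c *\<^sub>C f x) \<Longrightarrow> clinear f"
  by (simp add: clinear_iff)

lemma clinear_add: "clinear f \<Longrightarrow> f (x + y) = f x + f y"
  and clinear_scale: "clinear f \<Longrightarrow> f (c *\<^sub>C x) = c *\<^sub>C f x"
  by (simp_all add: clinear_iff)

lemma clinear_zero: "clinear f \<Longrightarrow> f 0 = 0"
  by (metis add_cancel_right_right clinear_iff)

lemma clinear_diff: "clinear f \<Longrightarrow> f (x - y) = f x - f y"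
  by (metis add_diff_cancel clinear_add diff_add_cancel)

lemma clinear_uminus: "clinear f \<Longrightarrow> f (- x) = - f x"
  by (metis clinear_diff clinear_zero diff_0)

lemma cbilinear_iff:
  "cbilinear f \<longleftrightarrow>
     (\<forall>a b c. f a (b + c) = f a b + f a c) \<and> (\<forall>a b c. f (a + b) c = f a c + f b c) \<and>
     (\<forall>k a b. f a (k *\<^sub>C b) = k *\<^sub>C f a b) \<and> (\<forall>k a b. f (k *\<^sub>C a) b = k *\<^sub>C f a b)"
  unfolding cbilinear_def clinear_iff by auto

instantiation complex :: complex_algebra
begin
definition "scaleC_complex = ((*) :: complex \<Rightarrow> complex \<Rightarrow> complex)"
instance by standard (simp_all add: scaleC_complex_def algebra_simps)
end

instantiation poly_mapping :: (type, complex_vector) complex_vector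
begin
definition scaleC_poly_mapping :: "complex \<Rightarrow> ('a \<Rightarrow>\<^sub>0 'b) \<Rightarrow> ('a \<Rightarrow>\<^sub>0 'b)"
  where "scaleC_poly_mapping c = Poly_Mapping.map (scaleC c)"

lemma lookup_scaleC: "Poly_Mapping.lookup (c *\<^sub>C p) k = c *\<^sub>C Poly_Mapping.lookup (p :: 'a \<Rightarrow>\<^sub>0 'b) k"
  by (simp add: scaleC_poly_mapping_def Poly_Mapping.map.rep_eq when_def)

instance
  by standard (auto intro!: poly_mapping_eqI
      simp: lookup_scaleC lookup_add scaleC_add_right scaleC_add_left scaleC_scaleC scaleC_one)
end

section \<open>Free vector spaces\<close>

text \<open>The linear extension of \<open>f\<close> to the complex vector space with basis \<open>'k\<close>.\<close>

definition lin_ext :: "('k \<Rightarrow> 'v::complex_vector) \<Rightarrow> ('k \<Rightarrow>\<^sub>0 complex) \<Rightarrow> 'v"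
  where "lin_ext f p = (\<Sum>k\<in>Poly_Mapping.keys p. Poly_Mapping.lookup p k *\<^sub>C f k)"

lemma lin_ext_superset:
  assumes "finite K" "Poly_Mapping.keys p \<subseteq> K"
  shows "lin_ext f p = (\<Sum>k\<in>K. Poly_Mapping.lookup p k *\<^sub>C f k)"
  unfolding lin_ext_def using assms
  by (intro sum.mono_neutral_left) (auto simp: in_keys_iff)

lemma clinear_lin_ext: "clinear (lin_ext f)"
proof (rule clinearI)
  fix p q :: "'a \<Rightarrow>\<^sub>0 complex" and c :: complex
  let ?K = "Poly_Mapping.keys p \<union> Poly_Mapping.keys q"
  have "Poly_Mapping.keys (p + q) \<subseteq> ?K" by (rule keys_add)
  then show "lin_ext f (p + q) = lin_ext f p + lin_ext f q"
    by (simp add: lin_ext_superset[of ?K] lookup_add scaleC_add_left sum.distrib)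
  have "Poly_Mapping.keys (c *\<^sub>C p) \<subseteq> Poly_Mapping.keys p"
    by (auto simp: in_keys_iff lookup_scaleC)
  then show "lin_ext f (c *\<^sub>C p) = c *\<^sub>C lin_ext f p"
    by (simp add: lin_ext_superset[of "Poly_Mapping.keys p"] lookup_scaleC scaleC_complex_def
        cvec.scale_sum_right)
qed

lemma lin_ext_single: "lin_ext f (Poly_Mapping.single k c) = c *\<^sub>C f k"
  by (simp add: lin_ext_def)

lemma single_eq_scaleC: "Poly_Mapping.single k c = c *\<^sub>C Poly_Mapping.single k (1::complex)"
  by (rule poly_mapping_eqI) (simp add: lookup_scaleC lookup_single when_def scaleC_complex_def)

lemma free_induct [case_names single add scale]:
  assumes "\<And>k. P (Poly_Mapping.single k (1::complex))"
    and "\<And>p q. P p \<Longrightarrow> P q \<Longrightarrow> P (p + q)"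
    and "\<And>c p. P p \<Longrightarrow> P (c *\<^sub>C p)"
  shows "P p"
proof (induction p rule: update_induct)
  case const
  fix k
  have "P (0 *\<^sub>C Poly_Mapping.single k (1::complex))" by (intro assms)
  then show "P 0" by simp
next
  case (update p a b)
  have "Poly_Mapping.update a b p = p + b *\<^sub>C Poly_Mapping.single a 1"
    using update
    by (intro poly_mapping_eqI)
       (auto simp: lookup_update lookup_add lookup_single when_def scaleC_complex_def
         lookup_scaleC in_keys_iff)
  then show "P (Poly_Mapping.update a b p)" using assms update by simp
qed

section \<open>Tensor products over the complex numbers\<close>

definition tensor_relators :: "('a::complex_vector \<times> 'b::complex_vector \<Rightarrow>\<^sub>0 complex) set" where
  "tensor_relators =
     {Poly_Mapping.single (a + a', b) 1 - Poly_Mapping.single (a, b) 1 - Poly_Mapping.single (a', b) 1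
       | a a' b. True} \<union>
     {Poly_Mapping.single (a, b + b') 1 - Poly_Mapping.single (a, b) 1 - Poly_Mapping.single (a, b') 1
       | a b b'. True} \<union>
     {Poly_Mapping.single (c *\<^sub>C a, b) 1 - c *\<^sub>C Poly_Mapping.single (a, b) 1 | c a b. True} \<union>
     {Poly_Mapping.single (a, c *\<^sub>C b) 1 - c *\<^sub>C Poly_Mapping.single (a, b) 1 | c a b. True}"

lemma equivp_mod_span: "equivp (\<lambda>x y. x - y \<in> cvec.span S)"
proof (rule equivpI)
  show "reflp (\<lambda>x y. x - y \<in> cvec.span S)" by (simp add: reflp_def cvec.span_zero)
  show "symp (\<lambda>x y. x - y \<in> cvec.span S)"
  proof (rule sympI)
    fix x y assume "x - y \<in> cvec.span S"
    then show "y - x \<in> cvec.span S" using cvec.span_neg[of "x - y" S] by simp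
  qed
  show "transp (\<lambda>x y. x - y \<in> cvec.span S)"
  proof (rule transpI)
    fix x y z assume "x - y \<in> cvec.span S" "y - z \<in> cvec.span S"
    then show "x - z \<in> cvec.span S" using cvec.span_add[of "x - y" S "y - z"] by simp
  qed
qed

lemma mod_span_add:
  "x - x' \<in> cvec.span S \<Longrightarrow> y - y' \<in> cvec.span S \<Longrightarrow> (x + y) - (x' + y') \<in> cvec.span S"
  using cvec.span_add[of "x - x'" S "y - y'"] by (simp add: add_diff_add)

lemma mod_span_diff:
  "x - x' \<in> cvec.span S \<Longrightarrow> y - y' \<in> cvec.span S \<Longrightarrow> (x - y) - (x' - y') \<in> cvec.span S"
proof -
  assume "x - x' \<in> cvec.span S" "y - y' \<in> cvec.span S"
  moreover have "(x - y) - (x' - y') = (x - x') - (y - y')" by simp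
  ultimately show ?thesis by (simp only: cvec.span_diff)
qed

lemma mod_span_uminus:
  "x - x' \<in> cvec.span S \<Longrightarrow> (- x) - (- x') \<in> cvec.span S"
  using cvec.span_neg[of "x - x'" S] by simp

lemma mod_span_scale:
  "x - x' \<in> cvec.span S \<Longrightarrow> (c *\<^sub>C x) - (c *\<^sub>C x') \<in> cvec.span S"
  using cvec.span_scale[of "x - x'" S c] by (simp add: cvec.scale_right_diff_distrib)

quotient_type (overloaded) ('a, 'b) tensor =
    "'a::complex_vector \<times> 'b::complex_vector \<Rightarrow>\<^sub>0 complex"
  / "\<lambda>p q. p - q \<in> cvec.span tensor_relators"
  by (rule equivp_mod_span)

instantiation tensor :: (complex_vector, complex_vector) complex_vector
begin
lift_definition zero_tensor :: "('a, 'b) tensor" is 0 .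
lift_definition plus_tensor :: "('a, 'b) tensor \<Rightarrow> ('a, 'b) tensor \<Rightarrow> ('a, 'b) tensor"
  is "(+)" by (rule mod_span_add)
lift_definition minus_tensor :: "('a, 'b) tensor \<Rightarrow> ('a, 'b) tensor \<Rightarrow> ('a, 'b) tensor"
  is "(-)" by (rule mod_span_diff)
lift_definition uminus_tensor :: "('a, 'b) tensor \<Rightarrow> ('a, 'b) tensor"
  is uminus by (rule mod_span_uminus)
lift_definition scaleC_tensor :: "complex \<Rightarrow> ('a, 'b) tensor \<Rightarrow> ('a, 'b) tensor"
  is scaleC by (rule mod_span_scale)
instance
  by standard (transfer; simp add: algebra_simps cvec.span_zero)+
end

lift_definition tensor :: "'a::complex_vector \<Rightarrow> 'b::complex_vector \<Rightarrow> ('a, 'b) tensor"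
  (infixr \<open>\<otimes>\<close> 75) is "\<lambda>a b. Poly_Mapping.single (a, b) 1" .

lemma cbilinear_tensor: "cbilinear (\<otimes>)"
  unfolding cbilinear_iff
proof (intro conjI allI; transfer)
  fix a a' :: 'a and b b' :: 'b and k :: complex
  show "Poly_Mapping.single (a, b + b') 1 - (Poly_Mapping.single (a, b) 1 + Poly_Mapping.single (a, b') 1)
      \<in> cvec.span tensor_relators"
    unfolding diff_diff_add[symmetric] tensor_relators_def
    by (rule cvec.span_base, rule UnI1, rule UnI1, rule UnI2) blast
  show "Poly_Mapping.single (a + a', b) 1 - (Poly_Mapping.single (a, b) 1 + Poly_Mapping.single (a', b) 1)
      \<in> cvec.span tensor_relators"
    unfolding diff_diff_add[symmetric] tensor_relators_def
    by (rule cvec.span_base, rule UnI1, rule UnI1, rule UnI1) blast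
  show "Poly_Mapping.single (a, k *\<^sub>C b) 1 - k *\<^sub>C Poly_Mapping.single (a, b) 1
      \<in> cvec.span tensor_relators"
    unfolding tensor_relators_def
    by (rule cvec.span_base, rule UnI2) blast
  show "Poly_Mapping.single (k *\<^sub>C a, b) 1 - k *\<^sub>C Poly_Mapping.single (a, b) 1
      \<in> cvec.span tensor_relators"
    unfolding tensor_relators_def
    by (rule cvec.span_base, rule UnI1, rule UnI2) blast
qed

lemma tensor_add_left: "(a + a') \<otimes> b = a \<otimes> b + a' \<otimes> b"
  and tensor_add_right: "a \<otimes> (b + b') = a \<otimes> b + a \<otimes> b'"
  and tensor_scale_left: "(c *\<^sub>C a) \<otimes> b = c *\<^sub>C (a \<otimes> b)"
  and tensor_scale_right: "a \<otimes> (c *\<^sub>C b) = c *\<^sub>C (a \<otimes> b)"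
  using cbilinear_tensor unfolding cbilinear_iff by blast+

lemma tensor_induct [case_names tensor add scale]:
  assumes "\<And>a b. P (a \<otimes> b)"
    and "\<And>s t. P s \<Longrightarrow> P t \<Longrightarrow> P (s + t)"
    and "\<And>c t. P t \<Longrightarrow> P (c *\<^sub>C t)"
  shows "P t"
proof -
  have "P (abs_tensor p)" for p
  proof (induction p rule: free_induct)
    case (single k)
    show ?case using assms(1)[of "fst k" "snd k"] by (simp add: tensor.abs_eq)
  next
    case (add p q)
    show ?case using assms(2)[OF add] by (simp only: plus_tensor.abs_eq)
  next
    case (scale c p)
    show ?case using assms(3)[OF scale] by (simp only: scaleC_tensor.abs_eq)
  qed
  from this[of "rep_tensor t"] show ?thesis
    by (simp only: Quotient3_abs_rep[OF Quotient3_tensor])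
qed

text \<open>The linear map on the tensor product induced by a bilinear map \<open>f\<close>. The value does not
  depend on the representative if \<open>f\<close> is bilinear, and only that case is used.\<close>

definition tensor_lift ::
    "('a::complex_vector \<Rightarrow> 'b::complex_vector \<Rightarrow> 'c::complex_vector) \<Rightarrow> ('a, 'b) tensor \<Rightarrow> 'c"
  where "tensor_lift f t = lin_ext (\<lambda>(a, b). f a b) (rep_tensor t)"

lemma clinear_span_zero:
  assumes "clinear g" "\<And>x. x \<in> S \<Longrightarrow> g x = 0" "x \<in> cvec.span S"
  shows "g x = 0"
  using assms(3)
proof (induction rule: cvec.span_induct)
  case base
  show ?case
    by (auto simp: cvec.subspace_def clinear_zero clinear_add clinear_scale assms(1))
next
  case (step x)
  then show ?case by (rule assms(2))
qed

lemma tensor_lift_abs: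
  assumes "cbilinear f"
  shows "tensor_lift f (abs_tensor p) = lin_ext (\<lambda>(a, b). f a b) p"
proof -
  let ?g = "lin_ext (\<lambda>(a, b). f a b)"
  have "rep_tensor (abs_tensor p) - p \<in> cvec.span tensor_relators"
    by (rule Quotient3_rep_abs[OF Quotient3_tensor]) (simp add: cvec.span_zero)
  moreover have "?g x = 0" if "x \<in> tensor_relators" for x
    using that assms clinear_lin_ext[of "\<lambda>(a, b). f a b"]
    by (auto simp: tensor_relators_def cbilinear_iff clinear_diff clinear_scale lin_ext_single
        scaleC_one)
  ultimately have "?g (rep_tensor (abs_tensor p) - p) = 0"
    using clinear_span_zero[OF clinear_lin_ext] by blast
  then show ?thesis by (simp add: tensor_lift_def clinear_diff[OF clinear_lin_ext])
qed

lemma tensor_lift_tensor: "cbilinear f \<Longrightarrow> tensor_lift f (a \<otimes> b) = f a b"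
  by (simp add: tensor.abs_eq tensor_lift_abs lin_ext_single scaleC_one)

lemma clinear_tensor_lift:
  assumes "cbilinear f"
  shows "clinear (tensor_lift f)"
proof (rule clinearI)
  fix s t :: "('a, 'b) tensor" and c :: complex
  obtain p q where pq: "s = abs_tensor p" "t = abs_tensor q"
    using Quotient3_abs_rep[OF Quotient3_tensor] by metis
  show "tensor_lift f (s + t) = tensor_lift f s + tensor_lift f t"
    by (simp add: pq plus_tensor.abs_eq tensor_lift_abs assms clinear_add[OF clinear_lin_ext])
  show "tensor_lift f (c *\<^sub>C s) = c *\<^sub>C tensor_lift f s"
    by (simp add: pq scaleC_tensor.abs_eq tensor_lift_abs assms clinear_scale[OF clinear_lin_ext])
qed

lemma clinear_eq_on_tensors:
  assumes "clinear f" "clinear g" "\<And>a b. f (a \<otimes> b) = g (a \<otimes> b)"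
  shows "f t = g t"
  by (induction t rule: tensor_induct) (simp_all add: assms clinear_add clinear_scale)

text \<open>A bilinear operation depending linearly on a parameter lifts to one that depends linearly
  on that parameter.\<close>

lemma tensor_lift_param:
  assumes "\<And>x. cbilinear (f x)" "\<And>a b. clinear (\<lambda>x. f x a b)"
  shows "clinear (\<lambda>x. tensor_lift (f x) t)"
proof (rule clinearI)
  fix x y :: 'a and c :: complex
  note L = clinear_tensor_lift[OF assms(1)]
  show "tensor_lift (f (x + y)) t = tensor_lift (f x) t + tensor_lift (f y) t"
  proof (rule clinear_eq_on_tensors[OF L])
    show "clinear (\<lambda>t. tensor_lift (f x) t + tensor_lift (f y) t)"
      by (rule clinearI)
         (simp_all only: clinear_add[OF L] clinear_scale[OF L] scaleC_add_right ac_simps)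
    show "tensor_lift (f (x + y)) (a \<otimes> b) =
        tensor_lift (f x) (a \<otimes> b) + tensor_lift (f y) (a \<otimes> b)" for a b
      by (simp only: tensor_lift_tensor[OF assms(1)] clinear_add[OF assms(2)])
  qed
  show "tensor_lift (f (c *\<^sub>C x)) t = c *\<^sub>C tensor_lift (f x) t"
  proof (rule clinear_eq_on_tensors[OF L])
    show "clinear (\<lambda>t. c *\<^sub>C tensor_lift (f x) t)"
      by (rule clinearI)
         (simp_all only: clinear_add[OF L] clinear_scale[OF L] scaleC_add_right scaleC_scaleC
            mult.commute)
    show "tensor_lift (f (c *\<^sub>C x)) (a \<otimes> b) = c *\<^sub>C tensor_lift (f x) (a \<otimes> b)" for a b
      by (simp only: tensor_lift_tensor[OF assms(1)] clinear_scale[OF assms(2)])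
  qed
qed

text \<open>The bilinear extension of an operation \<open>h p q r s\<close>, linear in each argument, to an operation
  on two tensors with factors \<open>p, q\<close> and \<open>r, s\<close>.\<close>

definition tensor_lift2 ::
    "('a::complex_vector \<Rightarrow> 'b::complex_vector \<Rightarrow> 'c::complex_vector \<Rightarrow> 'd::complex_vector
      \<Rightarrow> 'e::complex_vector) \<Rightarrow> ('a, 'b) tensor \<Rightarrow> ('c, 'd) tensor \<Rightarrow> 'e"
  where "tensor_lift2 h s t = tensor_lift (\<lambda>p q. tensor_lift (\<lambda>r s. h p q r s) t) s"

lemma tensor_lift2:
  assumes "\<And>p q. cbilinear (\<lambda>r s. h p q r s)" "\<And>r s. cbilinear (\<lambda>p q. h p q r s)"
  shows "tensor_lift2 h (p \<otimes> q) (r \<otimes> s) = h p q r s"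
    and "cbilinear (tensor_lift2 h)"
proof -
  have B: "cbilinear (\<lambda>p q. tensor_lift (\<lambda>r s. h p q r s) t)" for t
    unfolding cbilinear_def
    using assms(2) by (auto intro!: tensor_lift_param assms(1) simp: cbilinear_def)
  show "tensor_lift2 h (p \<otimes> q) (r \<otimes> s) = h p q r s"
    by (simp add: tensor_lift2_def tensor_lift_tensor B assms)
  show "cbilinear (tensor_lift2 h)"
    unfolding cbilinear_def tensor_lift2_def
    by (intro conjI allI clinear_tensor_lift B tensor_lift_param) (intro assms)
qed

section \<open>The componentwise product\<close>

lemma mult_scaleC_cbilinear:
  fixes a b :: "'a::complex_algebra" and c d :: "'b::complex_algebra"
  shows "cbilinear (\<lambda>x y. (a * x) \<otimes> (c * y))" "cbilinear (\<lambda>x y. (x * a) \<otimes> (y * c))"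
  by (auto simp: cbilinear_iff distrib_left distrib_right tensor_add_left tensor_add_right
      scaleC_mult_left scaleC_mult_right tensor_scale_left tensor_scale_right)

instantiation tensor :: (complex_algebra, complex_algebra) complex_algebra
begin
definition one_tensor :: "('a, 'b) tensor" where "1 = 1 \<otimes> 1"
definition times_tensor :: "('a, 'b) tensor \<Rightarrow> ('a, 'b) tensor \<Rightarrow> ('a, 'b) tensor"
  where "times_tensor = tensor_lift2 (\<lambda>p q r s. (p * r) \<otimes> (q * s))"

lemma tensor_mult: "(p \<otimes> q) * (r \<otimes> s) = (p * r) \<otimes> (q * s :: 'b)" for p :: 'a
  unfolding times_tensor_def by (intro tensor_lift2 mult_scaleC_cbilinear)

lemma cbilinear_tensor_mult: "cbilinear ((*) :: ('a, 'b) tensor \<Rightarrow> _)"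
  unfolding times_tensor_def by (intro tensor_lift2 mult_scaleC_cbilinear)

instance
proof
  fix x y z :: "('a, 'b) tensor" and c :: complex
  show D: "(x + y) * z = x * z + y * z" "x * (y + z) = x * y + x * z"
    for x y z :: "('a, 'b) tensor"
    using cbilinear_tensor_mult by (auto simp: cbilinear_iff)
  show S: "(c *\<^sub>C x) * y = c *\<^sub>C (x * y)" "x * (c *\<^sub>C y) = c *\<^sub>C (x * y)"
    for x y :: "('a, 'b) tensor" and c
    using cbilinear_tensor_mult by (auto simp: cbilinear_iff)
  have "(p \<otimes> q) * (r \<otimes> s) * z = (p \<otimes> q) * ((r \<otimes> s) * z)" for p r :: 'a and q s :: 'b
    by (induction z rule: tensor_induct) (simp_all add: D S tensor_mult mult.assoc)
  then have "(p \<otimes> q) * y * z = (p \<otimes> q) * (y * z)" for p :: 'a and q :: 'b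
    by (induction y rule: tensor_induct) (simp_all add: D S)
  then show "x * y * z = x * (y * z)"
    by (induction x rule: tensor_induct) (simp_all add: D S)
  show "1 * x = x"
    by (induction x rule: tensor_induct) (simp_all add: D S tensor_mult one_tensor_def)
  show "x * 1 = x"
    by (induction x rule: tensor_induct) (simp_all add: D S tensor_mult one_tensor_def)
qed
end

section \<open>Noncommutative vector fields\<close>

typedef (overloaded) 'a vfield =
  "{\<delta> :: 'a::complex_algebra \<Rightarrow> ('a, 'a) tensor.
     clinear \<delta> \<and> (\<forall>a b. \<delta> (a * b) = (a \<otimes> 1) * \<delta> b + \<delta> a * (1 \<otimes> b))}"
  morphisms vf_apply Abs_vfield
  by (rule exI[of _ "\<lambda>_. 0"]) (simp add: clinear_iff)

setup_lifting type_definition_vfield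

lemma clinear_vf_apply: "clinear (vf_apply \<delta>)"
  and vf_apply_mult: "vf_apply \<delta> (a * b) = (a \<otimes> 1) * vf_apply \<delta> b + vf_apply \<delta> a * (1 \<otimes> b)"
  using vf_apply[of \<delta>] by auto

instantiation vfield :: (complex_algebra) complex_vector
begin
lift_definition zero_vfield :: "'a vfield" is "\<lambda>_. 0"
  by (simp add: clinear_iff)
lift_definition plus_vfield :: "'a vfield \<Rightarrow> 'a vfield \<Rightarrow> 'a vfield" is "\<lambda>\<delta> \<eta> a. \<delta> a + \<eta> a"
  by (simp add: clinear_iff scaleC_add_right algebra_simps)
lift_definition minus_vfield :: "'a vfield \<Rightarrow> 'a vfield \<Rightarrow> 'a vfield" is "\<lambda>\<delta> \<eta> a. \<delta> a - \<eta> a"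
  by (simp add: clinear_iff cvec.scale_right_diff_distrib algebra_simps)
lift_definition uminus_vfield :: "'a vfield \<Rightarrow> 'a vfield" is "\<lambda>\<delta> a. - \<delta> a"
  by (simp add: clinear_iff algebra_simps)
lift_definition scaleC_vfield :: "complex \<Rightarrow> 'a vfield \<Rightarrow> 'a vfield" is "\<lambda>c \<delta> a. c *\<^sub>C \<delta> a"
  by (auto simp: clinear_iff scaleC_add_right scaleC_scaleC scaleC_mult_left scaleC_mult_right
      mult.commute)
instance
  by standard (transfer; simp add: fun_eq_iff algebra_simps)+
end

text \<open>The bimodule structure on vector fields comes from the inner bimodule structure of
  \<open>A \<otimes> A\<close>: the field \<open>a \<delta> b\<close> sends \<open>x\<close> to \<open>\<delta>(x)' b \<otimes> a \<delta>(x)''\<close>.\<close>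

lemma inner_outer_commute:
  "(1 \<otimes> a) * ((x \<otimes> 1) * t) = (x \<otimes> 1) * ((1 \<otimes> a) * t)"
  "t * (1 \<otimes> a) * (x \<otimes> 1) = t * (x \<otimes> 1) * (1 \<otimes> a)"
  for a x :: "'a::complex_algebra"
  by (simp_all add: tensor_mult mult.assoc flip: mult.assoc[of "_ \<otimes> _" "_ \<otimes> _" t])

lift_definition vf_lmult :: "'a::complex_algebra \<Rightarrow> 'a vfield \<Rightarrow> 'a vfield"
  is "\<lambda>a \<delta> x. (1 \<otimes> a) * \<delta> x"
  by (auto simp: clinear_iff distrib_left scaleC_mult_right inner_outer_commute mult.assoc)

lift_definition vf_rmult :: "'a::complex_algebra vfield \<Rightarrow> 'a \<Rightarrow> 'a vfield"
  is "\<lambda>\<delta> b x. \<delta> x * (b \<otimes> 1)"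
  by (auto simp: clinear_iff distrib_right scaleC_mult_left inner_outer_commute(2) mult.assoc[of "_ \<otimes> 1"])

section \<open>Bivector fields\<close>

text \<open>The degree two component \<open>D \<otimes>\<^sub>A D\<close> of the tensor algebra of the bimodule \<open>D\<close> of vector fields
  is the quotient of the tensor product over the complex numbers by the balancing relations. The
  product in the tensor algebra of two elements of degree one is the class of their tensor
  product.\<close>

definition balancing_relators :: "('a::complex_algebra vfield, 'a vfield) tensor set"
  where "balancing_relators =
    {vf_rmult \<delta> a \<otimes> \<eta> - \<delta> \<otimes> vf_lmult a \<eta> | \<delta> a \<eta>. True}"

quotient_type (overloaded) 'a bivector = "('a::complex_algebra vfield, 'a vfield) tensor"
  / "\<lambda>s t. s - t \<in> cvec.span balancing_relators"
  by (rule equivp_mod_span)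

instantiation bivector :: (complex_algebra) complex_vector
begin
lift_definition zero_bivector :: "'a bivector" is 0 .
lift_definition plus_bivector :: "'a bivector \<Rightarrow> 'a bivector \<Rightarrow> 'a bivector"
  is "(+)" by (rule mod_span_add)
lift_definition minus_bivector :: "'a bivector \<Rightarrow> 'a bivector \<Rightarrow> 'a bivector"
  is "(-)" by (rule mod_span_diff)
lift_definition uminus_bivector :: "'a bivector \<Rightarrow> 'a bivector"
  is uminus by (rule mod_span_uminus)
lift_definition scaleC_bivector :: "complex \<Rightarrow> 'a bivector \<Rightarrow> 'a bivector"
  is scaleC by (rule mod_span_scale)
instance
  by standard (transfer; simp add: algebra_simps cvec.span_zero)+
end

definition star :: "'a::complex_algebra vfield \<Rightarrow> 'a vfield \<Rightarrow> 'a bivector"  (infixl \<open>\<star>\<close> 70)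
  where "\<delta> \<star> \<eta> = abs_bivector (\<delta> \<otimes> \<eta>)"

section \<open>Biderivations and the partial trace\<close>

definition biderivation ::
    "(('a::complex_algebra, 'a) tensor \<Rightarrow> ('a, 'a) tensor) \<Rightarrow> bool"
  where "biderivation R \<longleftrightarrow> clinear R \<and>
    (\<forall>a b c. R ((a * b) \<otimes> c) = (1 \<otimes> a) * R (b \<otimes> c) + R (a \<otimes> c) * (b \<otimes> 1)) \<and>
    (\<forall>a b c. R (a \<otimes> (b * c)) = (b \<otimes> 1) * R (a \<otimes> c) + R (a \<otimes> b) * (1 \<otimes> c))"

text \<open>\<open>trace_pair\<close> is the operation \<open>(d' \<otimes> d'', e' \<otimes> e'') \<mapsto> e' d'' \<otimes> d' e''\<close>.\<close>

definition trace_pair ::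
    "('a::complex_algebra, 'a) tensor \<Rightarrow> ('a, 'a) tensor \<Rightarrow> ('a, 'a) tensor"
  where "trace_pair = tensor_lift2 (\<lambda>d' d'' e' e''. (e' * d'') \<otimes> (d' * e''))"

definition partial_trace ::
    "'a::complex_algebra bivector \<Rightarrow> ('a, 'a) tensor \<Rightarrow> ('a, 'a) tensor"
  where "partial_trace T t =
    tensor_lift (\<lambda>\<delta> \<eta>. tensor_lift (\<lambda>a b. trace_pair (vf_apply \<delta> a) (vf_apply \<eta> b)) t)
      (rep_bivector T)"

lemma cbilinear_trace_summand:
  fixes d' d'' e' e'' :: "'a::complex_algebra"
  shows "cbilinear (\<lambda>e' e''. (e' * d'') \<otimes> (d' * e''))"
    and "cbilinear (\<lambda>d' d''. (e' * d'') \<otimes> (d' * e''))"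
  by (auto simp: cbilinear_iff distrib_left distrib_right tensor_add_left tensor_add_right
      scaleC_mult_left scaleC_mult_right tensor_scale_left tensor_scale_right)

lemma trace_pair_tensor:
  "trace_pair (d' \<otimes> d'') (e' \<otimes> e'') = (e' * d'') \<otimes> (d' * e'')"
  unfolding trace_pair_def by (intro tensor_lift2 cbilinear_trace_summand)

lemma cbilinear_trace_pair: "cbilinear trace_pair"
  unfolding trace_pair_def by (intro tensor_lift2 cbilinear_trace_summand)

lemma trace_pair_add:
    "trace_pair (s + s') t = trace_pair s t + trace_pair s' t"
    "trace_pair s (t + t') = trace_pair s t + trace_pair s t'"
  and trace_pair_scale:
    "trace_pair (c *\<^sub>C s) t = c *\<^sub>C trace_pair s t"
    "trace_pair s (c *\<^sub>C t) = c *\<^sub>C trace_pair s t"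
  by (simp_all add: cbilinear_trace_pair[unfolded cbilinear_iff])

lemma trace_pair_balanced:
  "trace_pair (s * (a \<otimes> 1)) t = trace_pair s ((1 \<otimes> a) * t)"
proof -
  have "trace_pair ((p \<otimes> q) * (a \<otimes> 1)) t = trace_pair (p \<otimes> q) ((1 \<otimes> a) * t)" for p q
    by (induction t rule: tensor_induct)
       (simp_all add: trace_pair_add trace_pair_scale trace_pair_tensor tensor_mult mult.assoc
         distrib_left scaleC_mult_right)
  then show ?thesis
    by (induction s rule: tensor_induct)
       (simp_all add: trace_pair_add trace_pair_scale distrib_right scaleC_mult_left)
qed

lemma cbilinear_trace_vfields:
  "cbilinear (\<lambda>a b. trace_pair (vf_apply \<delta> a) (vf_apply \<eta> b))"
  by (auto simp: cbilinear_iff clinear_add[OF clinear_vf_apply] clinear_scale[OF clinear_vf_apply]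
      trace_pair_add trace_pair_scale)

lemma cbilinear_trace_lift:
  "cbilinear (\<lambda>\<delta> \<eta>. tensor_lift (\<lambda>a b. trace_pair (vf_apply \<delta> a) (vf_apply \<eta> b)) t)"
  unfolding cbilinear_def
  by (intro conjI allI tensor_lift_param cbilinear_trace_vfields)
     (auto simp: clinear_iff plus_vfield.rep_eq scaleC_vfield.rep_eq trace_pair_add trace_pair_scale)

lemma partial_trace_abs:
  "partial_trace (abs_bivector s) t =
    tensor_lift (\<lambda>\<delta> \<eta>. tensor_lift (\<lambda>a b. trace_pair (vf_apply \<delta> a) (vf_apply \<eta> b)) t) s"
proof -
  let ?g = "tensor_lift (\<lambda>\<delta> \<eta>. tensor_lift (\<lambda>a b. trace_pair (vf_apply \<delta> a) (vf_apply \<eta> b)) t)"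
  have lin: "clinear ?g" by (rule clinear_tensor_lift[OF cbilinear_trace_lift])
  have "rep_bivector (abs_bivector s) - s \<in> cvec.span balancing_relators"
    by (rule Quotient3_rep_abs[OF Quotient3_bivector]) (simp add: cvec.span_zero)
  moreover have "?g x = 0" if "x \<in> balancing_relators" for x
    using that
    by (auto simp: balancing_relators_def clinear_diff[OF lin]
        tensor_lift_tensor[OF cbilinear_trace_lift] vf_lmult.rep_eq vf_rmult.rep_eq
        trace_pair_balanced)
  ultimately have "?g (rep_bivector (abs_bivector s) - s) = 0"
    using clinear_span_zero[OF lin] by blast
  then show ?thesis by (simp add: partial_trace_def clinear_diff[OF lin])
qed

lemma partial_trace_star:
  "partial_trace (\<delta> \<star> \<eta>) (a \<otimes> b) = trace_pair (vf_apply \<delta> a) (vf_apply \<eta> b)"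
  unfolding star_def partial_trace_abs
  by (rule trans[OF tensor_lift_tensor[OF cbilinear_trace_lift]])
     (rule tensor_lift_tensor[OF cbilinear_trace_vfields])

lemma clinear_partial_trace:
  shows "clinear (\<lambda>T. partial_trace T t)" "clinear (partial_trace T)"
proof -
  note L = clinear_tensor_lift[OF cbilinear_trace_lift]
  show "clinear (\<lambda>T. partial_trace T t)"
  proof (rule clinearI)
    fix S T :: "'a bivector" and c :: complex
    obtain p q where pq: "S = abs_bivector p" "T = abs_bivector q"
      using Quotient3_abs_rep[OF Quotient3_bivector] by metis
    show "partial_trace (S + T) t = partial_trace S t + partial_trace T t"
      by (simp add: pq plus_bivector.abs_eq partial_trace_abs clinear_add[OF L])
    show "partial_trace (c *\<^sub>C S) t = c *\<^sub>C partial_trace S t"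
      by (simp add: pq scaleC_bivector.abs_eq partial_trace_abs clinear_scale[OF L])
  qed
  show "clinear (partial_trace T)"
    unfolding partial_trace_def
    by (intro tensor_lift_param cbilinear_trace_lift clinear_tensor_lift cbilinear_trace_vfields)
qed

lemma trace_pair_derivation:
  "trace_pair ((a \<otimes> 1) * s) t = (1 \<otimes> a) * trace_pair s t" (is "?P1 s")
  "trace_pair (s * (1 \<otimes> b)) t = trace_pair s t * (b \<otimes> 1)" (is "?P2 s")
  "trace_pair s ((b \<otimes> 1) * t) = (b \<otimes> 1) * trace_pair s t" (is "?P3 s")
  "trace_pair s (t * (1 \<otimes> c)) = trace_pair s t * (1 \<otimes> c)" (is "?P4 s")
proof -
  note simps = trace_pair_add trace_pair_scale distrib_left distrib_right
    scaleC_mult_left scaleC_mult_right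
  have tensors: "?P1 (p \<otimes> q) \<and> ?P2 (p \<otimes> q) \<and> ?P3 (p \<otimes> q) \<and> ?P4 (p \<otimes> q)" for p q
    by (induction t rule: tensor_induct)
       (simp_all add: simps trace_pair_tensor tensor_mult mult.assoc)
  have "?P1 s \<and> ?P2 s \<and> ?P3 s \<and> ?P4 s"
  proof (induction s rule: tensor_induct)
    case (tensor p q)
    show ?case by (rule tensors)
  qed (simp_all add: simps)
  then show "?P1 s" "?P2 s" "?P3 s" "?P4 s" by blast+
qed

lemma bivector_induct [case_names star add scale]:
  assumes "\<And>\<delta> \<eta>. P (\<delta> \<star> \<eta>)" "\<And>S T. P S \<Longrightarrow> P T \<Longrightarrow> P (S + T)" "\<And>c T. P T \<Longrightarrow> P (c *\<^sub>C T)"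
  shows "P T"
proof -
  have "P (abs_bivector t)" for t
  proof (induction t rule: tensor_induct)
    case (tensor \<delta> \<eta>)
    show ?case using assms(1)[of \<delta> \<eta>] by (simp only: star_def)
  next
    case (add s t)
    show ?case using assms(2)[OF add] by (simp only: plus_bivector.abs_eq)
  next
    case (scale c t)
    show ?case using assms(3)[OF scale] by (simp only: scaleC_bivector.abs_eq)
  qed
  from this[of "rep_bivector T"] show ?thesis
    by (simp only: Quotient3_abs_rep[OF Quotient3_bivector])
qed

lemma biderivation_partial_trace: "biderivation (partial_trace T)"
proof -
  note simps = clinear_add[OF clinear_partial_trace(1)] clinear_scale[OF clinear_partial_trace(1)]
    scaleC_add_right distrib_left distrib_right scaleC_mult_left scaleC_mult_right
  have "partial_trace T ((a * b) \<otimes> c) =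
      (1 \<otimes> a) * partial_trace T (b \<otimes> c) + partial_trace T (a \<otimes> c) * (b \<otimes> 1)" for a b c
    by (induction T rule: bivector_induct)
       (simp_all add: simps partial_trace_star vf_apply_mult trace_pair_add trace_pair_derivation)
  moreover have "partial_trace T (a \<otimes> (b * c)) =
      (b \<otimes> 1) * partial_trace T (a \<otimes> c) + partial_trace T (a \<otimes> b) * (1 \<otimes> c)" for a b c
    by (induction T rule: bivector_induct)
       (simp_all add: simps partial_trace_star vf_apply_mult trace_pair_add trace_pair_derivation)
  ultimately show ?thesis by (simp add: biderivation_def clinear_partial_trace)
qed

section \<open>Free algebras\<close>

text \<open>The free algebra is the monoid algebra of the free monoid. The monoid operation is written
  additively because the convolution product on \<^type>\<open>poly_mapping\<close> requires this.\<close>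

datatype 'x word = Word "'x list"

instantiation word :: (type) monoid_add
begin
definition "0 = Word []"
fun plus_word :: "'a word \<Rightarrow> 'a word \<Rightarrow> 'a word" where "Word xs + Word ys = Word (xs @ ys)"
instance
proof
  fix a b c :: "'a word"
  show "a + b + c = a + (b + c)" by (cases a; cases b; cases c) simp
  show "0 + a = a" "a + 0 = a" by (cases a; simp add: zero_word_def)+
qed
end

type_synonym 'x free_algebra = "'x word \<Rightarrow>\<^sub>0 complex"

lemma scaleC_poly_mapping_left:
  "c *\<^sub>C p = Poly_Mapping.single 0 (c *\<^sub>C 1) * p"
  for p :: "'k::monoid_add \<Rightarrow>\<^sub>0 'a::{complex_algebra, ring_1}"
proof -
  have "scaleC c = ((*) (c *\<^sub>C 1) :: 'a \<Rightarrow> 'a)" by (simp add: fun_eq_iff scaleC_mult_left)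
  then have "c *\<^sub>C p = Poly_Mapping.map ((*) (c *\<^sub>C 1)) p"
    unfolding scaleC_poly_mapping_def by (rule arg_cong)
  then show ?thesis by (simp only: mult_map_scale_conv_mult)
qed

lemma scaleC_poly_mapping_right:
  "c *\<^sub>C p = p * Poly_Mapping.single 0 (c *\<^sub>C 1)"
  for p :: "'k::monoid_add \<Rightarrow>\<^sub>0 'a::{complex_algebra, ring_1}"
proof (induction p rule: update_induct)
  case const
  show ?case by simp
next
  case (update p a b)
  have "Poly_Mapping.update a b p = p + Poly_Mapping.single a b"
    using update
    by (intro poly_mapping_eqI)
       (auto simp: lookup_update lookup_add lookup_single when_def in_keys_iff)
  moreover have "c *\<^sub>C Poly_Mapping.single a b = Poly_Mapping.single a b * Poly_Mapping.single 0 (c *\<^sub>C 1)"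
    by (simp add: scaleC_poly_mapping_left mult_single scaleC_mult_left scaleC_mult_right)
  ultimately show ?case using update by (simp add: scaleC_add_right distrib_right)
qed

instance poly_mapping :: (monoid_add, "{complex_algebra, ring_1}") complex_algebra
proof
  fix c and x y :: "'a \<Rightarrow>\<^sub>0 'b"
  show "(c *\<^sub>C x) * y = c *\<^sub>C (x * y)"
    by (simp add: scaleC_poly_mapping_left mult.assoc)
  show "x * (c *\<^sub>C y) = c *\<^sub>C (x * y)"
    by (simp add: scaleC_poly_mapping_right mult.assoc)
qed

definition gen :: "'x \<Rightarrow> 'x free_algebra"
  where "gen x = Poly_Mapping.single (Word [x]) 1"

text \<open>A vector field on a free algebra exists and is unique for arbitrary values on generators.\<close>

abbreviation monom :: "'x list \<Rightarrow> 'x free_algebra"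
  where "monom xs \<equiv> Poly_Mapping.single (Word xs) 1"

lemma monom_simps: "monom [] = 1" "monom (x # xs) = gen x * monom xs"
    "monom (xs @ ys) = monom xs * monom ys"
proof -
  show "monom [] = 1" by (simp flip: zero_word_def)
qed (simp_all add: gen_def mult_single)

primrec vf_word ::
    "('x \<Rightarrow> ('x free_algebra, 'x free_algebra) tensor) \<Rightarrow> 'x list
      \<Rightarrow> ('x free_algebra, 'x free_algebra) tensor"
  where "vf_word f [] = 0"
  | "vf_word f (x # xs) = (gen x \<otimes> 1) * vf_word f xs + f x * (1 \<otimes> monom xs)"

lemma vf_word_append:
  "vf_word f (xs @ ys) = (monom xs \<otimes> 1) * vf_word f ys + vf_word f xs * (1 \<otimes> monom ys)"
proof (induction xs)
  case Nil
  then show ?case by (simp add: monom_simps flip: one_tensor_def)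
next
  case (Cons x xs)
  have "(gen x \<otimes> 1) * ((monom xs \<otimes> 1) * vf_word f ys) = (monom (x # xs) \<otimes> 1) * vf_word f ys"
    by (simp add: monom_simps tensor_mult flip: mult.assoc)
  moreover have "f x * (1 \<otimes> monom (xs @ ys)) = f x * (1 \<otimes> monom xs) * (1 \<otimes> monom ys)"
    by (simp add: monom_simps tensor_mult mult.assoc)
  ultimately show ?case by (simp add: Cons algebra_simps)
qed

lemma free_algebra_induct [case_names monom add scale]:
  assumes "\<And>xs. P (monom xs)" "\<And>p q. P p \<Longrightarrow> P q \<Longrightarrow> P (p + q)" "\<And>c p. P p \<Longrightarrow> P (c *\<^sub>C p)"
  shows "P (p :: 'x free_algebra)"
proof (rule free_induct)
  show "P (Poly_Mapping.single w 1)" for w by (cases w) (simp only: assms(1))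
qed (fact assms)+

lemma ex1_vfield:
  fixes f :: "'x \<Rightarrow> ('x free_algebra, 'x free_algebra) tensor"
  shows "\<exists>!\<delta>. \<forall>x. vf_apply \<delta> (gen x) = f x"
proof (rule ex_ex1I)
  define D where "D = lin_ext (\<lambda>w. case w of Word xs \<Rightarrow> vf_word f xs)"
  have lin: "clinear D" unfolding D_def by (rule clinear_lin_ext)
  have mon: "D (monom xs) = vf_word f xs" for xs
    by (simp add: D_def lin_ext_single scaleC_one)
  note simps = clinear_add[OF lin] clinear_scale[OF lin] distrib_left distrib_right
    scaleC_mult_left scaleC_mult_right tensor_add_left tensor_add_right tensor_scale_left
    tensor_scale_right scaleC_add_right
  have "D (monom xs * b) = (monom xs \<otimes> 1) * D b + D (monom xs) * (1 \<otimes> b)" for xs b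
  proof (induction b rule: free_algebra_induct)
    case (monom ys)
    then show ?case by (simp add: mon vf_word_append flip: monom_simps(3))
  qed (simp_all add: simps)
  then have "D (a * b) = (a \<otimes> 1) * D b + D a * (1 \<otimes> b)" for a b
    by (induction a rule: free_algebra_induct) (simp_all add: simps)
  then have "vf_apply (Abs_vfield D) = D" by (simp add: lin Abs_vfield_inverse)
  moreover have "D (gen x) = f x" for x
    using mon[of "[x]"] by (simp add: monom_simps flip: one_tensor_def)
  ultimately show "\<exists>\<delta>. \<forall>x. vf_apply \<delta> (gen x) = f x" by metis
next
  fix \<delta> \<eta>
  assume gens: "\<forall>x. vf_apply \<delta> (gen x) = f x" "\<forall>x. vf_apply \<eta> (gen x) = f x"
  have one: "vf_apply \<zeta> 1 = 0" for \<zeta> :: "'x free_algebra vfield"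
    using vf_apply_mult[of \<zeta> 1 1] by (simp flip: one_tensor_def)
  have "vf_apply \<delta> a = vf_apply \<eta> a" for a
  proof (induction a rule: free_algebra_induct)
    case (monom xs)
    then show ?case
      by (induction xs) (simp_all add: monom_simps one vf_apply_mult gens)
  qed (simp_all add: clinear_add[OF clinear_vf_apply] clinear_scale[OF clinear_vf_apply])
  then show "\<delta> = \<eta>" by (simp add: vf_apply_inject[symmetric] fun_eq_iff)
qed

datatype generator = U | V

end

theory Submission
  imports Defs
begin

text \<open>
  Both sides are biderivations, and a biderivation of a free algebra is determined by its values
  on pairs of generators: the two Leibniz rules reduce words to letters one argument at a time
  (\<open>biderivation_free_eqI\<close>). It remains to compare four values. The fields \<open>\<delta>\<^sub>2\<close> and
  \<open>\<delta>\<^sub>2'\<close> vanish on \<open>v\<close>, so on \<open>v \<otimes> u\<close> only \<open>\<delta>\<^sub>1 \<star> \<delta>\<^sub>2\<close> contributes, with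
  \<open>uv \<otimes> 1\<close>; on \<open>u \<otimes> v\<close> only \<open>\<delta>\<^sub>2' \<star> \<delta>\<^sub>1'\<close> contributes, with \<open>vu \<otimes> 1\<close>; on
  \<open>v \<otimes> v\<close> neither does. On \<open>u \<otimes> u\<close> both give \<open>uu \<otimes> 1\<close> and cancel in the difference.
\<close>

lemma biderivation_add: "biderivation R \<Longrightarrow> R (s + t) = R s + R t"
  and biderivation_scale: "biderivation R \<Longrightarrow> R (c *\<^sub>C t) = c *\<^sub>C R t"
  and biderivation_mult_left:
    "biderivation R \<Longrightarrow> R ((a * b) \<otimes> d) = (1 \<otimes> a) * R (b \<otimes> d) + R (a \<otimes> d) * (b \<otimes> 1)"
  and biderivation_mult_right:
    "biderivation R \<Longrightarrow> R (a \<otimes> (b * d)) = (b \<otimes> 1) * R (a \<otimes> d) + R (a \<otimes> b) * (1 \<otimes> d)"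
  unfolding biderivation_def clinear_iff by blast+

text \<open>As for derivations, writing \<open>1\<close> as \<open>1 * 1\<close> in the Leibniz rule doubles the value.\<close>

lemma biderivation_one:
  assumes "biderivation R"
  shows "R (1 \<otimes> a) = 0" "R (a \<otimes> 1) = 0"
  using biderivation_mult_left[OF assms, of 1 1 a] biderivation_mult_right[OF assms, of a 1 1]
  by (simp_all flip: one_tensor_def)

text \<open>The right argument is reduced first, with a generator on the left; the result is then what the
  reduction of the left argument needs at each letter, for an arbitrary right argument.\<close>

lemma biderivation_free_eqI:
  fixes R S :: "('x free_algebra, 'x free_algebra) tensor
                 \<Rightarrow> ('x free_algebra, 'x free_algebra) tensor"
  assumes R: "biderivation R" and S: "biderivation S"
    and gens: "\<And>x y. R (gen x \<otimes> gen y) = S (gen x \<otimes> gen y)"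
  shows "R = S"
proof
  note simps = biderivation_add[OF R] biderivation_add[OF S]
    biderivation_scale[OF R] biderivation_scale[OF S]
    tensor_add_left tensor_add_right tensor_scale_left tensor_scale_right
  have gen_left: "R (gen x \<otimes> b) = S (gen x \<otimes> b)" for x b
  proof (induction b rule: free_algebra_induct)
    case (monom ys)
    show ?case
      by (induction ys)
         (simp_all add: monom_simps biderivation_one[OF R] biderivation_one[OF S]
           biderivation_mult_right[OF R] biderivation_mult_right[OF S] gens)
  qed (simp_all add: simps)
  have pure: "R (a \<otimes> b) = S (a \<otimes> b)" for a b
  proof (induction a rule: free_algebra_induct)
    case (monom xs)
    show ?case
      by (induction xs)
         (simp_all add: monom_simps biderivation_one[OF R] biderivation_one[OF S]
           biderivation_mult_left[OF R] biderivation_mult_left[OF S] gen_left)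
  qed (simp_all add: simps)
  show "R t = S t" for t
    by (rule clinear_eq_on_tensors[of R S]) (use R S pure in \<open>simp_all add: biderivation_def\<close>)
qed

lemma partial_trace_star_diff:
  "partial_trace (\<delta> \<star> \<eta> - \<delta>' \<star> \<eta>') (a \<otimes> b) =
    trace_pair (vf_apply \<delta> a) (vf_apply \<eta> b) - trace_pair (vf_apply \<delta>' a) (vf_apply \<eta>' b)"
  by (simp add: clinear_diff[OF clinear_partial_trace(1)] partial_trace_star)

lemma trace_pair_zero: "trace_pair 0 t = 0" "trace_pair s 0 = 0"
  using trace_pair_add(1)[of 0 0 t] trace_pair_add(2)[of s 0 0] by simp_all

theorem proposition28:
  fixes \<delta>\<^sub>1 \<delta>\<^sub>2 \<delta>\<^sub>1' \<delta>\<^sub>2' :: "generator free_algebra vfield"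
    and K :: "(generator free_algebra, generator free_algebra) tensor
                \<Rightarrow> (generator free_algebra, generator free_algebra) tensor"
  assumes "vf_apply \<delta>\<^sub>1 (gen U) = 1 \<otimes> gen U" and "vf_apply \<delta>\<^sub>1 (gen V) = 1 \<otimes> gen V"
    and "vf_apply \<delta>\<^sub>2 (gen U) = gen U \<otimes> 1" and "vf_apply \<delta>\<^sub>2 (gen V) = 0"
    and "vf_apply \<delta>\<^sub>1' (gen U) = gen U \<otimes> 1" and "vf_apply \<delta>\<^sub>1' (gen V) = gen V \<otimes> 1"
    and "vf_apply \<delta>\<^sub>2' (gen U) = 1 \<otimes> gen U" and "vf_apply \<delta>\<^sub>2' (gen V) = 0"
    and "biderivation K"
    and "K (gen U \<otimes> gen V) = - ((gen V * gen U) \<otimes> 1)"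
    and "K (gen V \<otimes> gen U) = (gen U * gen V) \<otimes> 1"
    and "K (gen U \<otimes> gen U) = 0" and "K (gen V \<otimes> gen V) = 0"
  shows "K = partial_trace (\<delta>\<^sub>1 \<star> \<delta>\<^sub>2 - \<delta>\<^sub>2' \<star> \<delta>\<^sub>1')"
proof (rule biderivation_free_eqI)
  show "biderivation K" by fact
  show "biderivation (partial_trace (\<delta>\<^sub>1 \<star> \<delta>\<^sub>2 - \<delta>\<^sub>2' \<star> \<delta>\<^sub>1'))"
    by (rule biderivation_partial_trace)
  show "K (gen x \<otimes> gen y) = partial_trace (\<delta>\<^sub>1 \<star> \<delta>\<^sub>2 - \<delta>\<^sub>2' \<star> \<delta>\<^sub>1') (gen x \<otimes> gen y)"
    for x y
    by (cases x; cases y)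
       (simp_all add: assms partial_trace_star_diff trace_pair_tensor trace_pair_zero)
qed

end
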